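(* For all sufficiently large $n$, there are at least $7n/12$ points in $[n]^2$ such that no four of them are collinear or concyclic; that is, $f_{\mathrm{circ}}(n) \ge 7n/12$.
   Context: $[n]=\{1,\dots,n\}$. $f_{\mathrm{circ}}(n)$ denotes the maximum size of a subset of $[n]^2$ containing no four distinct points that lie on a common circle, where a line is also considered a (degenerate) circle. *)

theory Defs
  imports "HOL-Analysis.Analysis"
begin

text \<open>
  The plane is \<^typ>\<open>real \<times> real\<close>, whose library metric is the Euclidean one;
  hence \<^const>\<open>sphere\<close> is an ordinary circle there.
\<close>

definition grid :: "nat \<Rightarrow> (real \<times> real) set" where
  "grid n = (\<lambda>(i, j). (real i, real j)) ` ({1..n} \<times> {1..n})"

definition concyclic :: "(real \<times> real) set \<Rightarrow> bool" where
  "concyclic T \<longleftrightarrow> (\<exists>c r. r > 0 \<and> T \<subseteq> sphere c r)"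

text \<open>Lines count as degenerate circles, so collinear quadruples are excluded as well.\<close>

definition no_four_on_circle :: "(real \<times> real) set \<Rightarrow> bool" where
  "no_four_on_circle S \<longleftrightarrow>
     (\<forall>T. T \<subseteq> S \<and> card T = 4 \<longrightarrow> \<not> collinear T \<and> \<not> concyclic T)"

definition f_circ :: "nat \<Rightarrow> nat" where
  "f_circ n = Max (card ` {S. S \<subseteq> grid n \<and> no_four_on_circle S})"

text \<open>The maximum is taken over a finite nonempty set, so \<^const>\<open>Max\<close> is meaningful.\<close>

lemma finite_grid: "finite (grid n)"
  by (simp add: grid_def)

lemma f_circ_Max_wf:
  shows "finite (card ` {S. S \<subseteq> grid n \<and> no_four_on_circle S})"
    and "card ` {S. S \<subseteq> grid n \<and> no_four_on_circle S} \<noteq> {}"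
proof -
  have "finite {S. S \<subseteq> grid n \<and> no_four_on_circle S}"
    by (rule finite_subset[of _ "Pow (grid n)"]) (auto simp: finite_grid)
  then show "finite (card ` {S. S \<subseteq> grid n \<and> no_four_on_circle S})"
    by simp
  have "no_four_on_circle {}"
    by (simp add: no_four_on_circle_def)
  then show "card ` {S. S \<subseteq> grid n \<and> no_four_on_circle S} \<noteq> {}"
    by blast
qed

end

theory Submission
  imports Defs "HOL-Number_Theory.Number_Theory" "HOL-Real_Asymp.Real_Asymp"
begin

text \<open>
  Let \<open>p\<close> be a prime with \<open>p mod 4 = 1\<close> and let \<open>w\<^sup>2 = -1\<close> modulo \<open>p\<close>. The curve \<open>x + w y = 2 t\<close>,
  \<open>x - w y = 2 t\<^sup>2\<close> over the field with \<open>p\<close> elements satisfies \<open>x\<^sup>2 + y\<^sup>2 = 4 t\<^sup>3\<close>, so the determinant that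
  vanishes on every concyclic or collinear quadruple becomes, up to a unit, a Vandermonde determinant
  in the parameters \<open>t\<close>. Hence integer points whose residues are distinct points of the curve contain
  no such quadruple. Averaging over the translates of the curve yields at least \<open>(min p n)\<^sup>2 / p\<close> such
  points in the grid of side \<open>n\<close>, which suffices if \<open>7 n / 12 \<le> p \<le> 12 n / 7\<close>. Such a prime exists for
  large \<open>n\<close> because, by a Chebyshev argument, there is a prime \<open>p\<close> with \<open>p mod 4 = 1\<close> and
  \<open>x / 2 < p \<le> x\<close> for all large \<open>x\<close>.
\<close>

subsection \<open>Chebyshev estimates modulo 4\<close>

text \<open>Since \<open>ln m\<close> is the sum of \<open>mangoldt d\<close> over the divisors of
  \<open>m\<close>, exchanging the sums leaves the multiples \<open>d * k\<close> of each
  \<open>d\<close>. The bound \<open>X\<close> may exceed \<open>x\<close>, so that sums for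
  different \<open>x\<close> share one range of \<open>d\<close>; the extra terms count an empty
  set.\<close>

lemma sum_ln_eq_sum_mangoldt:
  fixes P :: "nat \<Rightarrow> bool"
  assumes "x \<le> X"
  shows "(\<Sum>m | m \<in> {1..x} \<and> P m. ln (real m)) =
         (\<Sum>d = 1..X. mangoldt d * real (card {k \<in> {1..x div d}. P (d * k)}))"
proof -
  have "(\<Sum>m | m \<in> {1..x} \<and> P m. ln (real m)) =
        (\<Sum>m | m \<in> {1..x} \<and> P m. \<Sum>d | d \<in> {1..X} \<and> d dvd m. mangoldt d)"
  proof (rule sum.cong)
    fix m assume m: "m \<in> {m. m \<in> {1..x} \<and> P m}"
    then have "{d. d \<in> {1..X} \<and> d dvd m} = {d. d dvd m}"
      using assms by (auto dest: dvd_imp_le dvd_pos_nat simp: Suc_le_eq)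
    then show "ln (real m) = (\<Sum>d | d \<in> {1..X} \<and> d dvd m. mangoldt d)"
      using mangoldt_sum[of m, where 'a = real] m by simp
  qed simp
  also have "\<dots> = (\<Sum>d = 1..X. \<Sum>m | m \<in> {m. m \<in> {1..x} \<and> P m} \<and> d dvd m. mangoldt d)"
    by (rule sum.swap_restrict) auto
  also have "\<dots> = (\<Sum>d = 1..X. mangoldt d * real (card {k \<in> {1..x div d}. P (d * k)}))"
  proof (rule sum.cong)
    fix d assume d: "d \<in> {1..X}"
    have "{m. m \<in> {m. m \<in> {1..x} \<and> P m} \<and> d dvd m} = (\<lambda>k. d * k) ` {k \<in> {1..x div d}. P (d * k)}"
      using d by (auto simp: less_eq_div_iff_mult_less_eq ac_simps Suc_le_eq elim!: dvdE intro!: Nat.gr0I)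
    moreover have "inj_on (\<lambda>k. d * k) {k \<in> {1..x div d}. P (d * k)}"
      using d by (auto simp: inj_on_def)
    ultimately have "card {m. m \<in> {m. m \<in> {1..x} \<and> P m} \<and> d dvd m} = card {k \<in> {1..x div d}. P (d * k)}"
      by (simp add: card_image)
    then show "(\<Sum>m | m \<in> {m. m \<in> {1..x} \<and> P m} \<and> d dvd m. mangoldt d) =
        mangoldt d * real (card {k \<in> {1..x div d}. P (d * k)})"
      by simp
  qed simp
  finally show ?thesis .
qed

definition psi :: "nat \<Rightarrow> real" where
  "psi x = (\<Sum>d = 1..x. mangoldt d)"

definition ln_sum_mod4 :: "nat \<Rightarrow> nat \<Rightarrow> real" where
  "ln_sum_mod4 r x = (\<Sum>m | m \<in> {1..x} \<and> m mod 4 = r. ln (real m))"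

lemma card_mod4_eq_1: "card {k \<in> {1..y}. k mod 4 = (1::nat)} = (y + 3) div 4"
  and card_mod4_eq_3: "card {k \<in> {1..y}. k mod 4 = (3::nat)} = (y + 1) div 4"
proof (induction y)
  case (Suc y)
  {
    case 1
    have "{k \<in> {1..Suc y}. k mod 4 = 1} = 
      (if Suc y mod 4 = 1 then insert (Suc y) {k \<in> {1..y}. k mod 4 = 1} else {k \<in> {1..y}. k mod 4 = 1})"
      by (auto simp: le_Suc_eq)
    then have "card {k \<in> {1..Suc y}. k mod 4 = 1} = (if Suc y mod 4 = 1 then 1 else 0) + (y + 3) div 4"
      using Suc(1) by simp
    also have "\<dots> = (Suc y + 3) div 4" by presburger
    finally show ?case .
  next
    case 2
    have "{k \<in> {1..Suc y}. k mod 4 = 3} = 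
      (if Suc y mod 4 = 3 then insert (Suc y) {k \<in> {1..y}. k mod 4 = 3} else {k \<in> {1..y}. k mod 4 = 3})"
      by (auto simp: le_Suc_eq)
    then have "card {k \<in> {1..Suc y}. k mod 4 = 3} = (if Suc y mod 4 = 3 then 1 else 0) + (y + 1) div 4"
      using Suc(2) by simp
    also have "\<dots> = (Suc y + 1) div 4" by presburger
    finally show ?case .
  }
qed auto

text \<open>The units modulo 4 are 1 and 3, each its own inverse: \<open>d mod 4 = 3\<close> swaps
  the two odd classes of \<open>k\<close>, and an even \<open>d\<close> reaches neither.\<close>

lemma card_mult_mod4:
  fixes d y :: nat
  shows "card {k \<in> {1..y}. d * k mod 4 = 1} =
           (if d mod 4 = 1 then (y + 3) div 4 else if d mod 4 = 3 then (y + 1) div 4 else 0)"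
    and "card {k \<in> {1..y}. d * k mod 4 = 3} =
           (if d mod 4 = 1 then (y + 1) div 4 else if d mod 4 = 3 then (y + 3) div 4 else 0)"
proof -
  have *: "d * k mod 4 = (d mod 4) * (k mod 4) mod 4" for k by (simp add: mod_mult_eq)
  have d: "d mod 4 \<in> {0, 1, 2, 3}" and k: "k mod 4 \<in> {0, 1, 2, 3}" for k :: nat by auto
  have "d * k mod 4 = 1 \<longleftrightarrow> d mod 4 = 1 \<and> k mod 4 = 1 \<or> d mod 4 = 3 \<and> k mod 4 = 3"
    "d * k mod 4 = 3 \<longleftrightarrow> d mod 4 = 1 \<and> k mod 4 = 3 \<or> d mod 4 = 3 \<and> k mod 4 = 1" for k
    unfolding * using d k[of k] by (elim insertE; simp)+
  then show "card {k \<in> {1..y}. d * k mod 4 = 1} =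
           (if d mod 4 = 1 then (y + 3) div 4 else if d mod 4 = 3 then (y + 1) div 4 else 0)"
    "card {k \<in> {1..y}. d * k mod 4 = 3} =
           (if d mod 4 = 1 then (y + 1) div 4 else if d mod 4 = 3 then (y + 3) div 4 else 0)"
    using card_mod4_eq_1[of y] card_mod4_eq_3[of y] by auto
qed

text \<open>
  The combination \<open>2 G\<^sub>1(x) - 2 G\<^sub>1(x/2) - G\<^sub>1(x/3) - 2 G\<^sub>3(x/3)\<close>, where \<open>G\<^sub>r\<close> sums \<open>ln m\<close> over
  \<open>m \<le> x\<close> with \<open>m mod 4 = r\<close>, has no \<open>x ln x\<close> term because \<open>2 - 2/2 - 1/3 - 2/3 = 0\<close>; its main term is
  \<open>(ln 6 / 4) x\<close>. The counts below are its coefficients at \<open>mangoldt d\<close> for \<open>d mod 4 = 1\<close> and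
  \<open>d mod 4 = 3\<close>, with \<open>y = x div d\<close>. The excess \<open>s\<close> costs only \<open>psi (x/5) + psi (x/17)\<close>, which is below
  the main term, so the primes with \<open>y = 1\<close> must contribute.
\<close>

lemma count_combination_le:
  fixes y :: nat
  defines "s \<equiv> of_bool (y \<ge> 5) + of_bool (y \<ge> 17) :: real"
  shows "2 * real ((y + 3) div 4) - 2 * real ((y div 2 + 3) div 4) - real ((y div 3 + 3) div 4)
           - 2 * real ((y div 3 + 1) div 4) \<le> s + 2 * of_bool (y = 1)"
    and "2 * real ((y + 1) div 4) - 2 * real ((y div 2 + 1) div 4) - real ((y div 3 + 1) div 4)
           - 2 * real ((y div 3 + 3) div 4) \<le> s"
proof -
  \<comment> \<open>24 is the least common multiple of 4, 2 * 4 and 3 * 4, so each quotient is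
    linear in \<open>q\<close> plus a function of \<open>r\<close>. The \<open>q\<close> terms
    cancel in both combinations, since 12 - 6 - 2 - 4 = 0, and finitely many \<open>r\<close>
    remain.\<close>
  define q r where "q = y div 24" and "r = y mod 24"
  have y: "y = 24 * q + r" by (simp add: q_def r_def)
  have eqs: "(y + 3) div 4 = 6 * q + (r + 3) div 4" "(y + 1) div 4 = 6 * q + (r + 1) div 4"
    "(y div 2 + 3) div 4 = 3 * q + (r div 2 + 3) div 4" "(y div 2 + 1) div 4 = 3 * q + (r div 2 + 1) div 4"
    "(y div 3 + 3) div 4 = 2 * q + (r div 3 + 3) div 4" "(y div 3 + 1) div 4 = 2 * q + (r div 3 + 1) div 4"
    unfolding y by linarith+
  have "r < 24" by (simp add: r_def)
  then have r: "r \<in> {0,1,2,3,4,5,6,7,8,9,10,11,12,13,14,15,16,17,18,19,20,21,22,23}"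
    by (simp add: eval_nat_numeral less_Suc_eq)
  have "y = 1 \<longleftrightarrow> q = 0 \<and> r = 1"
    unfolding y by presburger
  then have s: "s = (if q = 0 then of_bool (r \<ge> 5) + of_bool (r \<ge> 17) else 2)"
    "of_bool (y = 1) = (of_bool (q = 0 \<and> r = 1) :: real)"
    by (auto simp: s_def y)
  show "2 * real ((y + 3) div 4) - 2 * real ((y div 2 + 3) div 4) - real ((y div 3 + 3) div 4)
           - 2 * real ((y div 3 + 1) div 4) \<le> s + 2 * of_bool (y = 1)"
    unfolding eqs s using r by (elim insertE) auto
  show "2 * real ((y + 1) div 4) - 2 * real ((y div 2 + 1) div 4) - real ((y div 3 + 1) div 4)
           - 2 * real ((y div 3 + 3) div 4) \<le> s"
    unfolding eqs s using r by (elim insertE) auto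
qed

text \<open>For positive \<open>d\<close>, \<open>d <= x div a\<close> is equivalent to
  \<open>a <= x div d\<close>. In this form \<open>psi\<close> can be compared with the counts
  coefficient by coefficient.\<close>

lemma psi_div_eq:
  assumes "a > 0"
  shows "psi (x div a) = (\<Sum>d = 1..x. mangoldt d * of_bool (x div d \<ge> a))"
proof -
  have "{d \<in> {1..x}. x div d \<ge> a} = {1..x div a}"
    using assms by (auto simp: less_eq_div_iff_mult_less_eq ac_simps)
      (metis One_nat_def Suc_leI le_trans mult.commute mult_le_mono1 nat_mult_1)
  then show ?thesis
    by (simp add: psi_def of_bool_def if_distrib[of "(*) _"] flip: sum.inter_filter cong: if_cong)
qed

text \<open>Expanded over the common range \<open>d <= x\<close>, the left side has coefficient
  \<open>h d\<close> at \<open>mangoldt d\<close>; it vanishes for even \<open>d\<close> and is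
  bounded by \<open>count_combination_le\<close> with \<open>y = x div d\<close> for odd
  \<open>d\<close>.\<close>

lemma chebyshev_mod4:
  "2 * ln_sum_mod4 1 x - 2 * ln_sum_mod4 1 (x div 2) - ln_sum_mod4 1 (x div 3) - 2 * ln_sum_mod4 3 (x div 3)
     \<le> psi (x div 5) + psi (x div 17) + 2 * (\<Sum>d | d \<in> {1..x} \<and> x div d = 1 \<and> d mod 4 = 1. mangoldt d)"
proof -
  define c where "c r d y = real (card {k \<in> {1..y}. d * k mod 4 = r})" for r d y :: nat
  define h where "h d = 2 * c 1 d (x div d) - 2 * c 1 d (x div d div 2) - c 1 d (x div d div 3)
      - 2 * c 3 d (x div d div 3)" for d
  have G: "ln_sum_mod4 r (x div a) = (\<Sum>d = 1..x. mangoldt d * c r d (x div d div a))" for r a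
    unfolding ln_sum_mod4_def c_def
    by (subst sum_ln_eq_sum_mangoldt[of _ x]) (auto simp: div_mult2_eq[symmetric] mult.commute)
  have "2 * ln_sum_mod4 1 x - 2 * ln_sum_mod4 1 (x div 2) - ln_sum_mod4 1 (x div 3) - 2 * ln_sum_mod4 3 (x div 3)
      = (\<Sum>d = 1..x. mangoldt d * h d)"
    unfolding G G[of 1 1, unfolded div_by_1] sum_distrib_left sum_subtractf[symmetric]
    by (intro sum.cong refl) (simp add: h_def algebra_simps)
  also have "\<dots> \<le> (\<Sum>d = 1..x. mangoldt d * (of_bool (x div d \<ge> 5) + of_bool (x div d \<ge> 17)
      + 2 * of_bool (x div d = 1 \<and> d mod 4 = 1)))"
  proof (intro sum_mono mult_left_mono mangoldt_nonneg)
    fix d :: nat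
    consider "d mod 4 = 1" | "d mod 4 = 3" | "d mod 4 \<noteq> 1" "d mod 4 \<noteq> 3" by blast
    then show "h d \<le> of_bool (x div d \<ge> 5) + of_bool (x div d \<ge> 17) + 2 * of_bool (x div d = 1 \<and> d mod 4 = 1)"
    proof cases
      case 1
      then show ?thesis
        unfolding h_def c_def card_mult_mod4 using count_combination_le(1)[of "x div d"]
        by (simp only: simp_thms if_True)
    next
      case 2
      then have "d mod 4 \<noteq> 1" by simp
      then show ?thesis
        unfolding h_def c_def card_mult_mod4 using count_combination_le(2)[of "x div d"] 2
        by (simp only: simp_thms if_True if_False of_bool_eq mult_zero_right add_0_right)
    next
      case 3
      then show ?thesis
        unfolding h_def c_def card_mult_mod4 by simp
    qed
  qed
  also have "\<dots> = psi (x div 5) + psi (x div 17) + 2 * (\<Sum>d = 1..x. mangoldt d * of_bool (x div d = 1 \<and> d mod 4 = 1))"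
    by (simp only: psi_div_eq zero_less_numeral distrib_left sum.distrib sum_distrib_left mult.left_commute[of _ 2])
  also have "(\<Sum>d = 1..x. mangoldt d * of_bool (x div d = 1 \<and> d mod 4 = 1)) = 
      (\<Sum>d | d \<in> {1..x} \<and> x div d = 1 \<and> d mod 4 = 1. mangoldt d :: real)"
    by (simp add: of_bool_def if_distrib[of "(*) _"] flip: sum.inter_filter cong: if_cong)
  finally show ?thesis .
qed

section \<open>Asymptotics of the logarithm sums\<close>

text \<open>The derivative of \<open>t * ln t - t\<close> is \<open>ln t\<close>, so the mean value
  theorem applies on an interval of length 4, the period of the residue classes.\<close>

lemma mult_ln_minus_self_step:
  fixes t :: real
  assumes "t > 0"
  shows "4 * ln t \<le> ((t + 4) * ln (t + 4) - (t + 4)) - (t * ln t - t)"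
    and "((t + 4) * ln (t + 4) - (t + 4)) - (t * ln t - t) \<le> 4 * ln (t + 4)"
proof -
  have "\<exists>z. t < z \<and> z < t + 4 \<and>
      ((t + 4) * ln (t + 4) - (t + 4)) - (t * ln t - t) = (t + 4 - t) * ln z"
    using assms by (intro MVT2) (auto intro!: derivative_eq_intros)
  then obtain z where z: "t < z" "z < t + 4"
    "((t + 4) * ln (t + 4) - (t + 4)) - (t * ln t - t) = (t + 4 - t) * ln z"
    by blast
  have "ln t \<le> ln z" "ln z \<le> ln (t + 4)"
    using z(1,2) assms by simp_all
  then show "4 * ln t \<le> ((t + 4) * ln (t + 4) - (t + 4)) - (t * ln t - t)"
    "((t + 4) * ln (t + 4) - (t + 4)) - (t * ln t - t) \<le> 4 * ln (t + 4)"
    unfolding z(3) by simp_all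
qed

lemma ln_sum_mod4_add_4:
  assumes "r < 4"
  obtains m where "x < m" "m \<le> x + 4" "ln_sum_mod4 r (x + 4) = ln_sum_mod4 r x + ln (real m)"
proof -
  obtain q s where x: "x = 4 * q + s" "s < 4"
    by (metis mod_less_divisor mult_div_mod_eq zero_less_numeral)
  \<comment> \<open>The least number above \<open>x\<close> in the residue class
    \<open>r\<close>.\<close>
  define m where "m = (if r \<le> s then 4 * Suc q + r else 4 * q + r)"
  have m: "x < m" "m \<le> x + 4"
    using assms x by (simp_all add: m_def)
  have "m mod 4 = r"
    using assms by (auto simp: m_def simp del: mult_Suc_right)
  note m = m this
  have uniq: "k = m" if k: "k mod 4 = r" "x < k" "k \<le> x + 4" for k
  proof -
    obtain a b where "k = 4 * a + r" "m = 4 * b + r"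
      using k(1) m(3) by (metis mult_div_mod_eq)
    moreover from this have "a \<le> b" "b \<le> a"
      using k m by linarith+
    ultimately show ?thesis by simp
  qed
  have "{k. k \<in> {1..x + 4} \<and> k mod 4 = r} = insert m {k. k \<in> {1..x} \<and> k mod 4 = r}" (is "?L = ?R")
  proof
    show "?L \<subseteq> ?R"
    proof
      fix k assume "k \<in> ?L"
      then show "k \<in> ?R" using uniq[of k] by (cases "k \<le> x") auto
    qed
    show "?R \<subseteq> ?L" using m by auto
  qed
  then have "ln_sum_mod4 r (x + 4) = ln_sum_mod4 r x + ln (real m)"
    using m by (simp add: ln_sum_mod4_def)
  with m that show thesis by blast
qed

text \<open>Induction in steps of 4. The term gained between \<open>y\<close> and
  \<open>y + 4\<close> is at most \<open>ln (y + 4)\<close>; the shift by 4 in the bound makes its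
  increment start exactly there. \<open>C\<close> absorbs the values below 4.\<close>

lemma ln_sum_mod4_le:
  assumes "r < 4"
  shows "\<exists>C. \<forall>x. ln_sum_mod4 r x \<le> ((real x + 4) * ln (real x + 4) - (real x + 4)) / 4 + C"
proof -
  define h where "h t = t * ln t - t" for t :: real
  define C where "C = (\<Sum>x<4. \<bar>ln_sum_mod4 r x - h (real x + 4) / 4\<bar>)"
  have "ln_sum_mod4 r x \<le> h (real x + 4) / 4 + C" for x
  proof (induction x rule: less_induct)
    case (less x)
    show ?case
    proof (cases "x < 4")
      case True
      then have "\<bar>ln_sum_mod4 r x - h (real x + 4) / 4\<bar> \<le> C"
        unfolding C_def by (intro member_le_sum) auto
      then show ?thesis by linarith
    next
      case False
      define y where "y = x - 4"
      with False have x: "x = y + 4" by simp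
      obtain m where m: "y < m" "m \<le> y + 4" "ln_sum_mod4 r (y + 4) = ln_sum_mod4 r y + ln (real m)"
        using ln_sum_mod4_add_4[OF assms] by blast
      have "ln (real m) \<le> ln (real y + 4)" using m by simp
      moreover have "4 * ln (real y + 4) \<le> h (real y + 4 + 4) - h (real y + 4)"
        using mult_ln_minus_self_step(1)[of "real y + 4"] by (simp add: h_def)
      moreover have "ln_sum_mod4 r y \<le> h (real y + 4) / 4 + C"
        using less.IH[of y] x by simp
      ultimately show ?thesis unfolding x m(3) by simp
    qed
  qed
  then show ?thesis unfolding h_def by blast
qed

text \<open>The mirror image: the gained term is at least \<open>ln (y + 1)\<close>, and the shift
  by 3 makes the increment of the bound end there. Starting at 4 keeps \<open>y - 3\<close>
  positive.\<close>

lemma ln_sum_mod4_ge: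
  assumes "r < 4"
  shows "\<exists>C. \<forall>x\<ge>4. ((real x - 3) * ln (real x - 3) - (real x - 3)) / 4 - C \<le> ln_sum_mod4 r x"
proof -
  define h where "h t = t * ln t - t" for t :: real
  define C where "C = (\<Sum>x<8. \<bar>ln_sum_mod4 r x - h (real x - 3) / 4\<bar>)"
  have "h (real x - 3) / 4 - C \<le> ln_sum_mod4 r x" if "x \<ge> 4" for x
    using that
  proof (induction x rule: less_induct)
    case (less x)
    show ?case
    proof (cases "x < 8")
      case True
      then have "\<bar>ln_sum_mod4 r x - h (real x - 3) / 4\<bar> \<le> C"
        unfolding C_def by (intro member_le_sum) auto
      then show ?thesis by linarith
    next
      case False
      define y where "y = x - 4"
      with False have x: "x = y + 4" and y: "y \<ge> 4" by simp_all
      obtain m where m: "y < m" "m \<le> y + 4" "ln_sum_mod4 r (y + 4) = ln_sum_mod4 r y + ln (real m)"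
        using ln_sum_mod4_add_4[OF assms] by blast
      have "ln (real y + 1) \<le> ln (real m)" using m by (subst ln_le_cancel_iff) auto
      moreover have "h (real y + 1) - h (real y - 3) \<le> 4 * ln (real y + 1)"
        using mult_ln_minus_self_step(2)[of "real y - 3"] y by (simp add: h_def algebra_simps)
      moreover have "h (real y - 3) / 4 - C \<le> ln_sum_mod4 r y"
        using less.IH[of y] x y by simp
      ultimately show ?thesis unfolding x m(3) by (simp add: add.commute)
    qed
  qed
  then show ?thesis unfolding h_def by blast
qed

text \<open>Raised to the tenth power, the claim follows from
  \<open>2.72 ^ 17 <= 6 ^ 10\<close>.\<close>

lemma ln_6_ge: "ln (6 :: real) \<ge> 17 / 10"
proof -
  have "exp (17 / 10 :: real) ^ 10 = exp 1 ^ 17"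
    by (simp flip: exp_of_nat_mult)
  also have "\<dots> \<le> (272 / 100) ^ 17"
    using e_less_272 by (intro power_mono) auto
  also have "\<dots> \<le> (6 :: real) ^ 10" by (simp add: power_divide)
  finally have "exp (17 / 10 :: real) \<le> 6" by (subst (asm) power_mono_iff) auto
  then show ?thesis by (subst ln_ge_iff) auto
qed

text \<open>This is the Chebyshev combination with each logarithm sum replaced by its bound; the
  last two sums share the argument \<open>x / 3\<close> and merge into weight 3. The
  \<open>x ln x\<close> terms cancel.\<close>

lemma chebyshev_mod4_main_term:
  fixes C :: real
  shows "eventually (\<lambda>x::real. ((x - 3) * ln (x - 3) - (x - 3)) / 2 - ((x / 2 + 4) * ln (x / 2 + 4) - (x / 2 + 4)) / 2
     - 3 * (((x / 3 + 4) * ln (x / 3 + 4) - (x / 3 + 4)) / 4) - C \<ge> 42 / 100 * x) at_top"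
  (is "eventually (\<lambda>x. ?F x \<ge> _) _")
proof -
  have "((\<lambda>x. ?F x / x) \<longlongrightarrow> - (1 / 2) - (- (ln 2 / 2) - 1 / 2) / 2 - (- ln 3 - 1) / 4) at_top"
    by (real_asymp simp: ln_div)
  \<comment> \<open>The limit equals \<open>ln 6 / 4\<close>, which is at least 0.425.\<close>
  moreover have "- (1 / 2) - (- (ln 2 / 2) - 1 / 2) / 2 - (- ln 3 - 1) / 4 > (42 / 100 :: real)"
    using ln_6_ge ln_mult[of 2 "3::real"] by (simp add: field_simps)
  ultimately have "eventually (\<lambda>x. ?F x / x > 42 / 100) at_top"
    by (rule order_tendstoD)
  then show ?thesis
    using eventually_gt_at_top[of 0]
  proof eventually_elim
    case (elim x)
    from elim(1) show ?case
      unfolding pos_less_divide_eq[OF elim(2)] by (rule less_imp_le)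
  qed
qed

section \<open>An upper bound for psi\<close>

text \<open>Chebyshev's argument: with \<open>k = x div 2\<close>, the difference of the two
  \<open>psi\<close> values is at most the logarithm of \<open>fact x / (fact k)^2\<close>, which is
  nearly a central binomial coefficient.\<close>

lemma psi_le_psi_half:
  assumes "x > 0"
  shows "psi x \<le> psi (x div 2) + real x * ln 2 + ln (real x)"
proof -
  have ln_fact: "ln (fact n) = (\<Sum>d = 1..x. mangoldt d * real (n div d))" if "n \<le> x" for n
  proof -
    have "ln (fact n :: real) = (\<Sum>m = 1..n. ln (real m))"
      unfolding fact_prod of_nat_prod by (subst ln_prod) auto
    also have "{1..n} = {m. m \<in> {1..n} \<and> True}" by (auto simp del: One_nat_def)
    finally have "ln (fact n :: real) = (\<Sum>m | m \<in> {1..n} \<and> True. ln (real m))" .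
    moreover have "{k \<in> {1..y}. True} = {1..y}" for y :: nat by blast
    ultimately show ?thesis
      unfolding sum_ln_eq_sum_mangoldt[OF that] by simp
  qed
  define k where "k = x div 2"
  have k: "k \<le> x" "x - k \<le> k + 1" "k + 1 \<le> x" using assms by (auto simp: k_def)
  have "psi x - psi k = (\<Sum>d = 1..x. mangoldt d * of_bool (x div d \<ge> 1)) - (\<Sum>d = 1..x. mangoldt d * of_bool (x div d \<ge> 2))"
    using psi_div_eq[of 1 x] psi_div_eq[of 2 x] by (simp add: k_def)
  also have "\<dots> = (\<Sum>d = 1..x. mangoldt d * (of_bool (x div d \<ge> 1) - of_bool (x div d \<ge> 2)))"
    by (simp only: right_diff_distrib sum_subtractf)
  \<comment> \<open>With \<open>y = x div d\<close> the new coefficient is \<open>y mod 2\<close>,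
    and the old one is 1 for \<open>y = 1\<close> and 0 otherwise.\<close>
  also have "\<dots> \<le> (\<Sum>d = 1..x. mangoldt d * (real (x div d) - 2 * real (k div d)))"
  proof (intro sum_mono mult_left_mono mangoldt_nonneg)
    fix d
    have "k div d = x div d div 2" by (simp add: k_def div_mult2_eq[symmetric] mult.commute)
    then show "of_bool (x div d \<ge> 1) - of_bool (x div d \<ge> 2) \<le> real (x div d) - 2 * real (k div d)"
      by (cases "x div d \<ge> 2") auto
  qed
  also have "\<dots> = ln (fact x) - 2 * ln (fact k)"
    unfolding ln_fact[OF order_refl] ln_fact[OF k(1)] sum_distrib_left sum_subtractf[symmetric]
    by (simp add: algebra_simps)
  also have "\<dots> \<le> real x * ln 2 + ln (real x)"
  proof -
    \<comment> \<open>For odd \<open>x\<close> the quotient exceeds the binomial coefficient by the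
      factor \<open>k + 1\<close>; bounding it by \<open>x\<close> costs the summand
      \<open>ln x\<close>.\<close>
    have "fact (x - k) \<le> (fact (k + 1) :: nat)" by (rule fact_mono) (use k in auto)
    also have "\<dots> = (k + 1) * fact k" by simp
    also have "\<dots> \<le> x * fact k" using k(3) by (rule mult_le_mono1)
    finally have 1: "fact k * fact (x - k) \<le> fact k * (x * fact k :: nat)" by simp
    have "fact x = fact k * fact (x - k) * (x choose k)"
      using binomial_fact_lemma[OF k(1)] by simp
    also have "\<dots> \<le> fact k * (x * fact k) * 2 ^ x"
      by (intro mult_mono 1 binomial_le_pow2) auto
    finally have "real (fact x) \<le> real (fact k * (x * fact k) * 2 ^ x)"
      by (rule of_nat_mono)
    then have "ln (fact x :: real) \<le> ln (fact k * (x * fact k) * 2 ^ x)"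
      using assms by (subst ln_le_cancel_iff) auto
    then show ?thesis using assms by (simp add: ln_mult ln_realpow)
  qed
  finally show ?thesis by (simp add: k_def)
qed

text \<open>As \<open>ln 2 < 3 / 4\<close>, one halving costs at most \<open>3 / 4 * x\<close> for
  large \<open>x\<close>, and \<open>3 / 2 * (x / 2) + 3 / 4 * x = 3 / 2 * x\<close> closes the
  induction.\<close>

lemma psi_le: "\<exists>B. \<forall>x. psi x \<le> 3 / 2 * real x + B"
proof -
  have "eventually (\<lambda>x::real. x * ln 2 + ln x \<le> 3 / 4 * x) at_top"
  proof -
    have "((\<lambda>x::real. (x * ln 2 + ln x) / x) \<longlongrightarrow> ln 2) at_top" by real_asymp
    moreover have "ln 2 < (3 / 4 :: real)"
      using ln2_le_25_over_36 by simp
    ultimately have "eventually (\<lambda>x::real. (x * ln 2 + ln x) / x < 3 / 4) at_top"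
      by (rule order_tendstoD)
    then show ?thesis
      using eventually_gt_at_top[of 0] by eventually_elim (simp add: pos_less_divide_eq pos_divide_less_eq)
  qed
  then have "eventually (\<lambda>x::nat. real x * ln 2 + ln (real x) \<le> 3 / 4 * real x) sequentially"
    by (rule eventually_nat_real)
  then obtain x0 where x0: "\<And>x. x \<ge> x0 \<Longrightarrow> real x * ln 2 + ln (real x) \<le> 3 / 4 * real x"
    by (auto simp: eventually_sequentially)
  have psi_nonneg: "psi x \<ge> 0" for x by (simp add: psi_def sum_nonneg mangoldt_nonneg)
  define B where "B = (\<Sum>x\<le>x0. psi x)"
  have "psi x \<le> 3 / 2 * real x + B" for x
  proof (induction x rule: less_induct)
    case (less x)
    show ?case
    proof (cases "x \<le> x0")
      case True
      then have "psi x \<le> B" unfolding B_def by (intro member_le_sum) (auto simp: psi_nonneg)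
      then show ?thesis by simp
    next
      case False
      then have "psi x \<le> psi (x div 2) + (real x * ln 2 + ln (real x))"
        using psi_le_psi_half[of x] by simp
      also have "\<dots> \<le> (3 / 2 * real (x div 2) + B) + 3 / 4 * real x"
        using False by (intro add_mono less.IH x0) auto
      also have "real (x div 2) \<le> real x / 2" by simp
      finally show ?thesis by simp
    qed
  qed
  then show ?thesis by blast
qed

lemma mult_ln_minus_self_mono:
  fixes s t :: real
  assumes "1 \<le> s" "s \<le> t"
  shows "s * ln s - s \<le> t * ln t - t"
proof (rule DERIV_nonneg_imp_nondecreasing[OF assms(2)])
  fix z assume "s \<le> z" "z \<le> t"
  then show "\<exists>y. ((\<lambda>z. z * ln z - z) has_real_derivative y) (at z) \<and> 0 \<le> y"
    using assms by (intro exI[of _ "ln z"]) (auto intro!: derivative_eq_intros)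
qed

section \<open>Removing prime powers and finding the prime\<close>

text \<open>Only powers \<open>p ^ k <= x\<close> with \<open>k >= 2\<close> contribute, so
  \<open>p <= sqrt x\<close> and \<open>k <= log 2 x\<close>; each contributes at most
  \<open>ln x\<close>.\<close>

lemma sum_mangoldt_nonprime_le:
  fixes x :: nat
  assumes "x > 0"
  shows "(\<Sum>d | d \<in> {1..x} \<and> \<not> prime d. mangoldt d) \<le> (sqrt x + 1) * (log 2 x + 1) * ln x"
proof -
  define P where "P = {..nat \<lfloor>sqrt x\<rfloor>}"
  define K where "K = {..nat \<lfloor>log 2 x\<rfloor>}"
  define D where "D = {d. d \<in> {1..x} \<and> \<not> prime d \<and> primepow d}"
  have "D \<subseteq> (\<lambda>(p, k). p ^ k) ` (P \<times> K)"
  proof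
    fix d assume d: "d \<in> D"
    then obtain p k where pk: "prime p" "k > 0" "d = p ^ k"
      by (auto simp: D_def primepow_def)
    with d have "k \<noteq> 1" by (auto simp: D_def)
    with pk have "k \<ge> 2" by simp
    have dx: "p ^ k \<le> x" using d pk by (simp add: D_def)
    have "p\<^sup>2 \<le> p ^ k" using \<open>k \<ge> 2\<close> prime_gt_0_nat[OF pk(1)] by (intro power_increasing) auto
    with dx have "real (p\<^sup>2) \<le> real x" by (intro of_nat_mono) simp
    then have "real p \<le> sqrt x" by (intro real_le_rsqrt) simp
    then have "p \<in> P" by (simp add: P_def le_nat_floor)
    have "2 ^ k \<le> p ^ k" using prime_ge_2_nat[OF pk(1)] by (intro power_mono) auto
    with dx have "real (2 ^ k) \<le> real x" by (intro of_nat_mono) simp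
    then have "real k \<le> log 2 x" using assms by (simp add: le_log_iff powr_realpow)
    then have "k \<in> K" by (simp add: K_def le_nat_floor)
    with \<open>p \<in> P\<close> pk(3) show "d \<in> (\<lambda>(p, k). p ^ k) ` (P \<times> K)" by force
  qed
  then have "card D \<le> card (P \<times> K)"
    by (intro surj_card_le) (auto simp: P_def K_def)
  also have "real \<dots> \<le> (sqrt x + 1) * (log 2 x + 1)"
    using assms unfolding card_cartesian_product of_nat_mult P_def K_def card_atMost
    by (intro mult_mono) auto
  finally have card: "real (card D) \<le> (sqrt x + 1) * (log 2 x + 1)" by simp
  have "(\<Sum>d | d \<in> {1..x} \<and> \<not> prime d. mangoldt d) = (\<Sum>d\<in>D. mangoldt d :: real)"
    by (intro sum.mono_neutral_right) (auto simp: D_def mangoldt_def)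
  also have "\<dots> \<le> (\<Sum>d\<in>D. ln x)"
  proof (intro sum_mono)
    fix d assume "d \<in> D"
    then have "0 < d" "d \<le> x" by (auto simp: D_def)
    then show "mangoldt d \<le> ln x"
      using mangoldt_le[of d] by (auto intro: order_trans)
  qed
  also have "\<dots> \<le> (sqrt x + 1) * (log 2 x + 1) * ln x"
    using card assms by (simp add: mult_right_mono)
  finally show ?thesis .
qed

text \<open>The condition \<open>x div p = 1\<close> says \<open>x / 2 < p <= x\<close>. The
  Chebyshev inequality leaves a linear lower bound for the von Mangoldt sum over such numbers in the
  class 1 modulo 4, more than proper prime powers can supply.\<close>

lemma eventually_prime_1_mod_4:
  "eventually (\<lambda>x. \<exists>p. prime p \<and> p mod 4 = 1 \<and> x div p = 1) sequentially"
proof -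
  define h where "h t = t * ln t - t" for t :: real
  obtain C1 where C1: "\<And>x. x \<ge> 4 \<Longrightarrow> h (real x - 3) / 4 - C1 \<le> ln_sum_mod4 1 x"
    using ln_sum_mod4_ge[of 1] unfolding h_def by auto
  obtain C2 where C2: "\<And>x. ln_sum_mod4 1 x \<le> h (real x + 4) / 4 + C2"
    using ln_sum_mod4_le[of 1] unfolding h_def by auto
  obtain C3 where C3: "\<And>x. ln_sum_mod4 3 x \<le> h (real x + 4) / 4 + C3"
    using ln_sum_mod4_le[of 3] unfolding h_def by auto
  obtain B where B: "\<And>x. psi x \<le> 3 / 2 * real x + B"
    using psi_le by auto
  have "eventually (\<lambda>x. h (real x - 3) / 2 - h (real x / 2 + 4) / 2 - 3 * (h (real x / 3 + 4) / 4)
      - (2 * C1 + 3 * C2 + 2 * C3) \<ge> 42 / 100 * real x) sequentially"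
    unfolding h_def by (intro eventually_nat_real chebyshev_mod4_main_term)
  moreover have "eventually (\<lambda>x. 2 * ((sqrt (real x) + 1) * (log 2 (real x) + 1) * ln (real x)) + 2 * B
      < 3 / 100 * real x) sequentially"
  proof -
    have "eventually (\<lambda>x::real. 2 * ((sqrt x + 1) * (log 2 x + 1) * ln x) + 2 * B
      < 3 / 100 * x) at_top"
      by real_asymp
    then show ?thesis by (rule eventually_nat_real)
  qed
  ultimately show ?thesis
    using eventually_ge_at_top[of 4]
  proof eventually_elim
    case (elim x)
    \<comment> \<open>Rounding \<open>x / a\<close> down is harmless in the upper bounds:
      \<open>h\<close> increases from 1 on, and both arguments are at least 4.\<close>
    have h: "h (real (x div a) + 4) \<le> h (real x / a + 4)" for a :: nat
      unfolding h_def by (intro mult_ln_minus_self_mono) (auto intro: of_nat_div_le_of_nat)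
    define Q where "Q = {d. d \<in> {1..x} \<and> x div d = 1 \<and> d mod 4 = 1}"
    have "42 / 100 * real x \<le> 2 * ln_sum_mod4 1 x - 2 * ln_sum_mod4 1 (x div 2)
        - ln_sum_mod4 1 (x div 3) - 2 * ln_sum_mod4 3 (x div 3)"
      using elim(1) C1[OF elim(3)] C2[of "x div 2"] C2[of "x div 3"] C3[of "x div 3"] h[of 2] h[of 3] by simp
    also have "\<dots> \<le> psi (x div 5) + psi (x div 17) + 2 * (\<Sum>d\<in>Q. mangoldt d)"
      unfolding Q_def by (rule chebyshev_mod4)
    \<comment> \<open>\<open>3 / 2 * (1 / 5 + 1 / 17) = 33 / 85\<close>, slightly below
      0.39.\<close>
    also have "psi (x div 5) + psi (x div 17) \<le> 39 / 100 * real x + 2 * B"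
      using B[of "x div 5"] B[of "x div 17"] of_nat_div_le_of_nat[of x 5, where 'a = real] of_nat_div_le_of_nat[of x 17, where 'a = real] by simp
    finally have "3 / 100 * real x \<le> 2 * (\<Sum>d\<in>Q. mangoldt d) + 2 * B" by simp
    with elim(2) have *: "(sqrt x + 1) * (log 2 x + 1) * ln x < (\<Sum>d\<in>Q. mangoldt d)" by simp
    have "\<exists>p\<in>Q. prime p"
    proof (rule ccontr)
      assume "\<not> (\<exists>p\<in>Q. prime p)"
      then have "(\<Sum>d\<in>Q. mangoldt d :: real) \<le> (\<Sum>d | d \<in> {1..x} \<and> \<not> prime d. mangoldt d)"
        by (intro sum_mono2) (auto simp: Q_def mangoldt_nonneg)
      with sum_mangoldt_nonprime_le[of x] elim(3) * show False by simp
    qed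
    then show ?case by (auto simp: Q_def)
  qed
qed

subsection \<open>A curve modulo p without concyclic quadruples\<close>

text \<open>Twice the signed area of the triangle \<open>i\<close>, \<open>j\<close>,
  \<open>k\<close>; these are the minors in the expansion of the determinant below along its last
  column.\<close>

definition area :: "(nat \<Rightarrow> 'a) \<Rightarrow> (nat \<Rightarrow> 'a) \<Rightarrow> nat \<Rightarrow> nat \<Rightarrow> nat \<Rightarrow> 'a :: comm_ring_1" where
  "area x y i j k = (x j - x i) * (y k - y i) - (x k - x i) * (y j - y i)"

text \<open>The determinant of the matrix with rows \<open>(1, x i, y i, q i)\<close> for \<open>i = 0, \<dots>, 3\<close>, up to sign.\<close>

definition circle_det :: "(nat \<Rightarrow> 'a) \<Rightarrow> (nat \<Rightarrow> 'a) \<Rightarrow> (nat \<Rightarrow> 'a) \<Rightarrow> 'a :: comm_ring_1" where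
  "circle_det x y q = q 0 * area x y 1 2 3 - q 1 * area x y 0 2 3 + q 2 * area x y 0 1 3 - q 3 * area x y 0 1 2"

text \<open>The last column is then a linear combination of the other three. The equation of a
  circle has this shape with \<open>q = x^2 + y^2\<close>.\<close>

lemma circle_det_eq_0:
  assumes "\<And>i. i < 4 \<Longrightarrow> q i = B * x i + C * y i + E"
  shows "circle_det x y q = 0"
  using assms[of 0] assms[of 1] assms[of 2] assms[of 3]
  by (simp add: circle_det_def area_def algebra_simps)

lemma circle_det_of_int:
  "circle_det (\<lambda>i. of_int (x i)) (\<lambda>i. of_int (y i)) (\<lambda>i. of_int (q i)) = of_int (circle_det x y q)"
  by (simp add: circle_det_def area_def)

lemma cong_circle_det:
  fixes x y q :: "nat \<Rightarrow> int"
  assumes "\<And>i. i < 4 \<Longrightarrow> [x i = x' i] (mod p)" "\<And>i. i < 4 \<Longrightarrow> [y i = y' i] (mod p)"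
    "\<And>i. i < 4 \<Longrightarrow> [q i = q' i] (mod p)"
  shows "[circle_det x y q = circle_det x' y' q'] (mod p)"
  unfolding circle_det_def area_def by (intro cong_add cong_diff cong_mult assms) simp_all

text \<open>The columns are combinations of \<open>1\<close>, \<open>t\<close>, \<open>t^2\<close>,
  \<open>t^3\<close>, so the value is a Vandermonde determinant times 4 from the last column and
  \<open>2 * w\<close> from the change of basis between \<open>t\<close>, \<open>t^2\<close> and the
  two coordinates.\<close>

lemma circle_det_curve:
  fixes t :: "nat \<Rightarrow> 'a :: comm_ring_1"
  shows "circle_det (\<lambda>i. t i + t i ^ 2) (\<lambda>i. - (w * (t i - t i ^ 2))) (\<lambda>i. 4 * t i ^ 3) =
    - (8 * w * ((t 1 - t 0) * (t 2 - t 0) * (t 3 - t 0) * (t 2 - t 1) * (t 3 - t 1) * (t 3 - t 2)))"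
proof -
  have area: "area (\<lambda>i. t i + t i ^ 2) (\<lambda>i. - (w * (t i - t i ^ 2))) i j k =
      2 * w * ((t j - t i) * (t k - t i) * (t k - t j))" for i j k
    unfolding area_def by (simp add: algebra_simps power2_eq_square)
  show ?thesis
    unfolding circle_det_def area by (simp add: algebra_simps power3_eq_cube)
qed

text \<open>A concyclic or collinear quadruple makes the integer determinant zero, whereas modulo
  \<open>p\<close> it is a unit times a product of differences of distinct parameters.
  \<open>X\<close> and \<open>Y\<close> may be any integer representatives of a translate of the
  curve.\<close>

lemma no_four_on_circle_curve:
  fixes X Y :: "int \<Rightarrow> int" and p :: nat
  assumes p: "prime p" "p \<noteq> 2" and w: "[w ^ 2 = -1] (mod int p)"
    and A: "A \<subseteq> {0..<int p}"
    and X: "\<And>t. t \<in> A \<Longrightarrow> [X t = a + (t + t ^ 2)] (mod int p)"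
    and Y: "\<And>t. t \<in> A \<Longrightarrow> [Y t = b + - (w * (t - t ^ 2))] (mod int p)"
  shows "no_four_on_circle ((\<lambda>t. (of_int (X t), of_int (Y t))) ` A)"
  unfolding no_four_on_circle_def
proof (intro allI impI)
  define f where "f t = (of_int (X t) :: real, of_int (Y t) :: real)" for t
  fix T :: "(real \<times> real) set"
  assume T: "T \<subseteq> (\<lambda>t. (of_int (X t), of_int (Y t))) ` A \<and> card T = 4"
  then obtain U where U: "U \<subseteq> A" "inj_on f U" "T = f ` U"
    unfolding f_def[abs_def, symmetric] by (meson subset_image_inj)
  with T have "card U = 4" by (simp add: card_image)
  then obtain g where g: "bij_betw g {..<4::nat} U"
    by (metis card.infinite card_lessThan finite_lessThan finite_same_card_bij zero_neq_numeral)
  have gA: "g i \<in> A" and gT: "f (g i) \<in> T" if "i < 4" for i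
    using g U that by (auto simp: bij_betw_def)
  \<comment> \<open>Undoing the translation puts the residues on the curve itself, where
    \<open>x^2 + y^2\<close> is \<open>4 * t^3\<close> modulo \<open>p\<close>.\<close>
  define x where "x i = X (g i) - a" for i
  define y where "y i = Y (g i) - b" for i
  define q where "q i = x i ^ 2 + y i ^ 2" for i
  have "circle_det x y q \<noteq> 0"
  proof
    assume "circle_det x y q = 0"
    moreover have "[circle_det x y q = circle_det (\<lambda>i. g i + g i ^ 2) (\<lambda>i. - (w * (g i - g i ^ 2))) (\<lambda>i. 4 * g i ^ 3)] (mod int p)"
    proof (intro cong_circle_det)
      fix i :: nat assume i: "i < 4"
      show x: "[x i = g i + g i ^ 2] (mod int p)"
        using cong_diff[OF X[OF gA[OF i]] cong_refl[of a]] by (simp add: x_def)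
      show y: "[y i = - (w * (g i - g i ^ 2))] (mod int p)"
        using cong_diff[OF Y[OF gA[OF i]] cong_refl[of b]] by (simp add: y_def)
      have "[q i = (g i + g i ^ 2) ^ 2 + (- (w * (g i - g i ^ 2))) ^ 2] (mod int p)"
        unfolding q_def by (intro cong_add cong_pow x y)
      also have "(g i + g i ^ 2) ^ 2 + (- (w * (g i - g i ^ 2))) ^ 2 =
          (g i + g i ^ 2) ^ 2 + w ^ 2 * (g i - g i ^ 2) ^ 2"
        by (simp add: power_mult_distrib)
      also have "[\<dots> = (g i + g i ^ 2) ^ 2 + (-1) * (g i - g i ^ 2) ^ 2] (mod int p)"
        by (intro cong_add cong_mult w cong_refl)
      also have "(g i + g i ^ 2) ^ 2 + (-1) * (g i - g i ^ 2) ^ 2 = 4 * g i ^ 3"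
        by (simp add: algebra_simps power2_eq_square power3_eq_cube)
      finally show "[q i = 4 * g i ^ 3] (mod int p)" .
    qed
    ultimately have "int p dvd 8 * w * ((g 1 - g 0) * (g 2 - g 0) * (g 3 - g 0) * (g 2 - g 1) * (g 3 - g 1) * (g 3 - g 2))"
      unfolding circle_det_curve by (simp add: cong_iff_dvd_diff)
    moreover have "\<not> int p dvd g j - g i" if "i < 4" "j < 4" "i \<noteq> j" for i j
    proof -
      have "g i \<noteq> g j" using g that by (auto simp: bij_betw_def inj_on_def)
      moreover have "g i \<in> {0..<int p}" "g j \<in> {0..<int p}" using gA A that by blast+
      ultimately show ?thesis
        by (metis atLeastLessThan_iff mod_eq_dvd_iff mod_pos_pos_trivial)
    qed
    moreover have "\<not> int p dvd 8"
    proof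
      assume "int p dvd 8"
      then have "p dvd 2 ^ 3" by (simp add: int_dvd_int_iff[symmetric])
      with p show False by (meson prime_dvd_power primes_dvd_imp_eq two_is_prime_nat)
    qed
    moreover have "\<not> int p dvd w"
    proof
      assume "int p dvd w"
      then have "[0 = w ^ 2] (mod int p)" by (simp add: cong_iff_dvd_diff power2_eq_square)
      from cong_trans[OF this w] have "int p dvd 1" by (simp add: cong_iff_dvd_diff)
      with p show False by auto
    qed
    moreover have "prime (int p)" using p by simp
    ultimately show False by (auto simp: prime_dvd_mult_iff)
  qed
  moreover have "circle_det x y q = 0" if "collinear T \<or> concyclic T"
  proof -
    have "circle_det (\<lambda>i. of_int (x i)) (\<lambda>i. of_int (y i)) (\<lambda>i. of_int (q i)) = (0 :: real)"
      using that
    proof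
      assume "collinear T"
      then obtain u where u: "\<And>z z'. z \<in> T \<Longrightarrow> z' \<in> T \<Longrightarrow> \<exists>c. z - z' = c *\<^sub>R u"
        unfolding collinear_def by blast
      have "area (\<lambda>i. of_int (x i)) (\<lambda>i. of_int (y i)) i j k = (0 :: real)" if ijk: "i < 4" "j < 4" "k < 4" for i j k
      proof -
        obtain c d where "f (g j) - f (g i) = c *\<^sub>R u" "f (g k) - f (g i) = d *\<^sub>R u"
          using u[OF gT[OF ijk(2)] gT[OF ijk(1)]] u[OF gT[OF ijk(3)] gT[OF ijk(1)]] by blast
        then have "real_of_int (x j) - of_int (x i) = c * fst u" "real_of_int (y j) - of_int (y i) = c * snd u"
          "real_of_int (x k) - of_int (x i) = d * fst u" "real_of_int (y k) - of_int (y i) = d * snd u"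
          by (auto simp: f_def x_def y_def prod_eq_iff)
        then show ?thesis unfolding area_def by simp
      qed
      then show ?thesis unfolding circle_det_def by simp
    next
      assume "concyclic T"
      then obtain c r where c: "T \<subseteq> sphere c r" unfolding concyclic_def by blast
      define c1 c2 where "c1 = fst c - of_int a" and "c2 = snd c - of_int b"
      show ?thesis
      proof (rule circle_det_eq_0)
        fix i :: nat assume "i < 4"
        then have "dist c (f (g i)) = r" using c gT[of i] by auto
        then have "r\<^sup>2 = (fst c - of_int (X (g i)))\<^sup>2 + (snd c - of_int (Y (g i)))\<^sup>2"
          by (auto simp: dist_prod_def f_def dist_real_def)
        also have "\<dots> = (c1 - of_int (x i))\<^sup>2 + (c2 - of_int (y i))\<^sup>2"
          by (simp add: c1_def c2_def x_def y_def)
        finally show "of_int (q i) = 2 * c1 * of_int (x i) + 2 * c2 * of_int (y i) + (r\<^sup>2 - c1\<^sup>2 - c2\<^sup>2)"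
          by (simp add: q_def power2_eq_square algebra_simps)
      qed
    qed
    then show ?thesis unfolding circle_det_of_int by simp
  qed
  ultimately show "\<not> collinear T \<and> \<not> concyclic T" by blast
qed

section \<open>Averaging over translates\<close>

lemma card_shifts_into_interval:
  fixes x p m :: int
  assumes "0 \<le> m" "m \<le> p" "0 < p"
  shows "card {a \<in> {0..<p}. (x + a) mod p < m} = nat m"
proof -
  have "bij_betw (\<lambda>a. (x + a) mod p) {a \<in> {0..<p}. (x + a) mod p < m} {0..<m}"
    using assms by (intro bij_betw_byWitness[where f' = "\<lambda>s. (s - x) mod p"]) (auto simp: mod_simps)
  then show ?thesis by (simp add: bij_betw_same_card)
qed

text \<open>Double counting: each \<open>t\<close> lands in the box for exactly \<open>m^2\<close>
  of the \<open>p^2\<close> shifts, so the average count is \<open>m^2 / p\<close>.\<close>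

lemma exists_good_shift:
  fixes X Y :: "int \<Rightarrow> int" and p m :: int
  assumes "0 \<le> m" "m \<le> p" "0 < p"
  shows "\<exists>a b. int (card {t \<in> {0..<p}. (X t + a) mod p < m \<and> (Y t + b) mod p < m}) * p \<ge> m\<^sup>2"
proof (rule ccontr)
  define N where "N a b = card {t \<in> {0..<p}. (X t + a) mod p < m \<and> (Y t + b) mod p < m}" for a b
  assume "\<not> ?thesis"
  then have "int (N a b) * p < m\<^sup>2" for a b unfolding N_def using not_le by blast
  then have "(\<Sum>ab\<in>{0..<p} \<times> {0..<p}. int (N (fst ab) (snd ab)) * p) < (\<Sum>ab\<in>{0..<p} \<times> {0..<p}. m\<^sup>2)"
    using assms by (intro sum_strict_mono) auto
  also have "\<dots> = p\<^sup>2 * m\<^sup>2"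
    using assms by (simp add: power2_eq_square)
  also have "\<dots> = (\<Sum>t\<in>{0..<p}. m\<^sup>2) * p"
    using assms by (simp add: power2_eq_square)
  also have "(\<Sum>t\<in>{0..<p}. m\<^sup>2) = (\<Sum>t\<in>{0..<p}. int (card {ab \<in> {0..<p} \<times> {0..<p}. (X t + fst ab) mod p < m \<and> (Y t + snd ab) mod p < m}))"
  proof (intro sum.cong refl)
    fix t
    have "{ab \<in> {0..<p} \<times> {0..<p}. (X t + fst ab) mod p < m \<and> (Y t + snd ab) mod p < m} =
       {a \<in> {0..<p}. (X t + a) mod p < m} \<times> {b \<in> {0..<p}. (Y t + b) mod p < m}" by auto
    then show "m\<^sup>2 = int (card {ab \<in> {0..<p} \<times> {0..<p}. (X t + fst ab) mod p < m \<and> (Y t + snd ab) mod p < m})"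
      using assms by (simp only: card_cartesian_product card_shifts_into_interval power2_eq_square of_nat_mult nat_0_le)
  qed
  also have "\<dots> = (\<Sum>ab\<in>{0..<p} \<times> {0..<p}. int (N (fst ab) (snd ab)))"
    using sum.swap_restrict[of "{0..<p}" "{0..<p} \<times> {0..<p}" "\<lambda>_ _. 1 :: int"
        "\<lambda>t ab. (X t + fst ab) mod p < m \<and> (Y t + snd ab) mod p < m"]
    unfolding N_def sum_constant mult_1_right by simp
  finally show False by (simp add: sum_distrib_right)
qed

text \<open>Euler's criterion with even exponent \<open>(p - 1) div 2\<close>. As
  \<open>p > 2\<close>, the values 0 and -1 of the Legendre symbol are not congruent to 1.\<close>

lemma exists_sqrt_minus_one_mod:
  fixes p :: nat
  assumes "prime p" "p mod 4 = 1"
  shows "\<exists>w :: int. [w ^ 2 = -1] (mod int p)"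
proof -
  have "p > 2" using assms prime_ge_2_nat[of p] by (cases "p = 2") auto
  have "even ((p - 1) div 2)" using assms(2) by presburger
  then have L: "[Legendre (-1) p = 1] (mod int p)"
    using euler_criterion[OF assms(1) \<open>p > 2\<close>, of "-1"] by simp
  have "Legendre (-1) p \<noteq> 0" "Legendre (-1) p \<noteq> -1"
    using L \<open>p > 2\<close> by (auto simp: cong_iff_dvd_diff zdvd_not_zless dest: zdvd_imp_le)
  then show ?thesis
    by (auto simp: Legendre_def QuadRes_def split: if_splits)
qed

lemma no_four_on_circle_of_prime:
  fixes p n :: nat
  assumes p: "prime p" "p mod 4 = 1"
  shows "\<exists>S. S \<subseteq> grid n \<and> no_four_on_circle S \<and> (min p n)\<^sup>2 \<le> card S * p"
proof -
  have "p \<noteq> 2" using p by auto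
  have "prime (int p)" using p by simp
  obtain w where w: "[w ^ 2 = -1] (mod int p)" using exists_sqrt_minus_one_mod[OF p] by blast
  define m where "m = int (min p n)"
  have m: "0 \<le> m" "m \<le> int p" "m \<le> int n" "0 < int p"
    using prime_gt_0_nat[OF p(1)] by (auto simp: m_def)
  define X where "X t = t + t ^ 2" for t :: int
  define Y where "Y t = - (w * (t - t ^ 2))" for t :: int
  obtain a b where ab: "int (card {t \<in> {0..<int p}. (X t + a) mod int p < m \<and> (Y t + b) mod int p < m}) * int p \<ge> m\<^sup>2"
    using exists_good_shift[OF m(1,2,4)] by blast
  define A where "A = {t \<in> {0..<int p}. (X t + a) mod int p < m \<and> (Y t + b) mod int p < m}"
  \<comment> \<open>Residues start at 0 and grid coordinates at 1; for \<open>t\<close> in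
    \<open>A\<close> the shifted residue lies between 1 and \<open>m\<close>, hence in the
    grid.\<close>
  define X' where "X' t = 1 + (X t + a) mod int p" for t
  define Y' where "Y' t = 1 + (Y t + b) mod int p" for t
  define f where "f t = (real_of_int (X' t), real_of_int (Y' t))" for t
  have X': "[X' t = (1 + a) + (t + t ^ 2)] (mod int p)" and Y': "[Y' t = (1 + b) + - (w * (t - t ^ 2))] (mod int p)" for t
    unfolding X'_def Y'_def X_def Y_def by (simp_all add: cong_def mod_simps algebra_simps)
  have "no_four_on_circle (f ` A)"
    unfolding f_def using X' Y' by (intro no_four_on_circle_curve[OF p(1) \<open>p \<noteq> 2\<close> w]) (auto simp: A_def)
  moreover have "f ` A \<subseteq> grid n"
  proof
    fix z assume "z \<in> f ` A"
    then obtain t where t: "z = f t" "t \<in> A" by blast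
    then have "1 \<le> X' t" "X' t \<le> int n" "1 \<le> Y' t" "Y' t \<le> int n"
      using m by (auto simp: A_def X'_def Y'_def)
    then have "f t = (\<lambda>(i, j). (real i, real j)) (nat (X' t), nat (Y' t))"
      "(nat (X' t), nat (Y' t)) \<in> {1..n} \<times> {1..n}"
      by (auto simp: f_def)
    then show "z \<in> grid n" unfolding grid_def t by blast
  qed
  moreover have "inj_on f A"
  proof (rule inj_onI)
    fix s t assume st: "s \<in> A" "t \<in> A" "f s = f t"
    then have "X' s = X' t" "Y' s = Y' t" by (auto simp: f_def)
    then have "[1 + a + (s + s ^ 2) = 1 + a + (t + t ^ 2)] (mod int p)"
      "[1 + b + - (w * (s - s ^ 2)) = 1 + b + - (w * (t - t ^ 2))] (mod int p)"
      using X'[of s] X'[of t] Y'[of s] Y'[of t] by (metis cong_sym cong_trans)+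
    then have 1: "[s + s ^ 2 = t + t ^ 2] (mod int p)" and "[w * (s - s ^ 2) = w * (t - t ^ 2)] (mod int p)"
      by (simp_all only: cong_add_lcancel cong_minus_minus_iff)
    \<comment> \<open>Multiplying by \<open>w\<close> cancels the factor \<open>w\<close> up to
      sign; subtracting the result from the first congruence then removes the squares and leaves
      \<open>2 * s\<close> congruent to \<open>2 * t\<close>.\<close>
    from this(2) have "[w * (w * (s - s ^ 2)) = w * (w * (t - t ^ 2))] (mod int p)"
      by (rule cong_mult[OF cong_refl])
    moreover have "[w * (w * k) = - k] (mod int p)" for k
      using cong_mult[OF w cong_refl[of k]] by (simp add: power2_eq_square mult.assoc)
    ultimately have "[- (s - s ^ 2) = - (t - t ^ 2)] (mod int p)"
      by (meson cong_sym cong_trans)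
    from cong_diff[OF 1 this] have "int p dvd 2 * (s - t)"
      by (simp add: cong_iff_dvd_diff algebra_simps)
    moreover have "\<not> int p dvd 2"
      using \<open>p \<noteq> 2\<close> p(1) by (metis int_dvd_int_iff of_nat_numeral primes_dvd_imp_eq two_is_prime_nat)
    ultimately have "int p dvd s - t"
      using \<open>prime (int p)\<close> prime_dvd_mult_iff by blast
    with st show "s = t"
      by (auto simp: A_def) (metis mod_eq_dvd_iff mod_pos_pos_trivial)
  qed
  then have "card (f ` A) = card A" by (rule card_image)
  moreover have "(min p n)\<^sup>2 \<le> card A * p"
  proof -
    have "int ((min p n)\<^sup>2) \<le> int (card A * p)" using ab unfolding A_def m_def by simp
    then show ?thesis by (simp only: of_nat_le_iff)
  qed
  ultimately show ?thesis by metis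
qed

subsection \<open>The main result\<close>

theorem corollary1p4:
  shows "\<forall>\<^sub>F n in sequentially.
           (\<exists>S. S \<subseteq> grid n \<and> no_four_on_circle S \<and> real (card S) \<ge> 7 * real n / 12) \<and>
           real (f_circ n) \<ge> 7 * real n / 12"
proof -
  \<comment> \<open>With \<open>x = 12 * n div 7\<close> the prime satisfies
    \<open>6 * n / 7 < p <= 12 * n / 7\<close>. The upper end is the tight one, as it makes
    \<open>n^2 / p\<close> at least \<open>7 * n / 12\<close>.\<close>
  have "filterlim (\<lambda>n::nat. 12 * n div 7) sequentially sequentially"
    by (rule filterlim_at_top_mono[OF filterlim_ident]) (intro always_eventually allI, linarith)
  from eventually_compose_filterlim[OF eventually_prime_1_mod_4 this] show ?thesis
    using eventually_gt_at_top[of 0]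
  proof eventually_elim
    case (elim n)
    then obtain p where p: "prime p" "p mod 4 = 1" "12 * n div 7 div p = 1" by blast
    have "p > 0" using p(1) by (rule prime_gt_0_nat)
    then have "p \<le> 12 * n div 7" "12 * n div 7 < 2 * p"
      using p(3) div_less_iff_less_mult[of p "12 * n div 7" 2] less_eq_div_iff_mult_less_eq[of p 1 "12 * n div 7"] by auto
    then have le: "7 * p \<le> 12 * n" and ge: "7 * n \<le> 12 * p" by linarith+
    obtain S where S: "S \<subseteq> grid n" "no_four_on_circle S" "(min p n)\<^sup>2 \<le> card S * p"
      using no_four_on_circle_of_prime[OF p(1,2)] by blast
    \<comment> \<open>For \<open>p <= n\<close> the whole curve fits and gives \<open>p\<close>
      points; otherwise averaging gives at least \<open>n^2 / p\<close>.\<close>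
    have "7 * n \<le> 12 * card S"
    proof (cases "p \<le> n")
      case True
      then have "p \<le> card S" using S(3) \<open>p > 0\<close> by (simp add: power2_eq_square)
      with ge show ?thesis by simp
    next
      case False
      then have "7 * (n * n) \<le> card S * (7 * p)" using S(3) by (simp add: power2_eq_square)
      also have "\<dots> \<le> card S * (12 * n)" using le by (rule mult_le_mono2)
      finally have "7 * n * n \<le> 12 * card S * n" by (simp add: ac_simps)
      then show ?thesis using elim(2) by simp
    qed
    then have card: "7 * real n / 12 \<le> real (card S)" by linarith
    also have "card S \<le> f_circ n"
      unfolding f_circ_def using S f_circ_Max_wf(1)[of n] by (intro Max_ge) auto
    finally show ?case using S card by auto
  qed
qed

end
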